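(* Let $Q=R_1(V_1)\wedge\cdots\wedge R_m(V_m)$ be a full Berge-acyclic conjunctive query with variables $\mathbf V=\{X_1,\dots,X_n\}=V_1\cup\cdots\cup V_m$, and let $\Sigma$ be a finite set of statistics for $Q$, all of which are on simple and full degree sequences. Then the optimal values of the linear programs $\mathrm{LP}_{\mathrm{base}}(Q,\Sigma)$ and $\mathrm{LP}_{\mathrm{Berge}}(Q,\Sigma)$ are equal.
   Context: **Queries.** In the conjunctive query, $V_j$ is the finite non-empty set of variables of atom $R_j$; "full" means that the output variables are all of $\mathbf V$. $Q$ is acyclic if the atoms can be placed on the nodes of a tree such that for every variable $X_i$ the set of tree nodes whose atom contains $X_i$ is connected. $Q$ is Berge-acyclic if it is acyclic and any two atoms share at most one variable. **Statistics.** A statistic is a tuple $(j,U,V,p,b)$ with $U,V\subseteq V_j$, $p\in(0,\infty]$, and a real $b\ge1$; it represents the assertion $\|\deg_{R_j}(V|U)\|_p\le b$ on the $\ell_p$-norm of the degree sequence from $U$ to $V$ in $R_j$. It is simple if $|U|\le 1$ and full if $U\cup V=V_j$. Notation: $h(V|U)=h(U\cup V)-h(U)$; $\log$ is base 2; $1/\infty=0$; $h(\emptyset)=0$. **$\mathrm{LP}_{\mathrm{base}}(Q,\Sigma)$.** Variables $h(U)\ge0$ for all $U\subseteq\mathbf V$. Maximize $h(\mathbf V)$ subject to: $\frac1p h(U)+h(V|U)\le\log b$ for each $(j,U,V,p,b)\in\Sigma$; and the basic Shannon inequalities $h(\emptyset)=0$, $h(U\cup V)\ge h(U)$, $h(U)+h(V)\ge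 h(U\cup V)+h(U\cap V)$ for all $U,V\subseteq\mathbf V$. **$\mathrm{LP}_{\mathrm{Berge}}(Q,\Sigma)$.** Non-negative variables $h(X_1),\dots,h(X_n)$ and $h(V_1),\dots,h(V_m)$ (one variable per distinct set; if $V_j=\{X_i\}$ then $h(V_j)$ and $h(X_i)$ are the same variable). Let $a_i$ be the number of atoms containing $X_i$. Maximize $$E_Q=\sum_{j=1}^m h(V_j)-\sum_{i=1}^n(a_i-1)h(X_i)$$ subject to: - statistics constraints: $\frac1p h(U)+h(V|U)\le\log b$ for each $(j,U,V,p,b)\in\Sigma$ (these only involve the variables $h(X_1),\dots,h(X_n)$ and $h(V_1),\dots,h(V_m)$, together with the constant $h(\emptyset)=0$, since $|U|\le1$ and $U\cup V=V_j$); - additivity constraints: for each $j$, $h(V_j)\le\sum_{X_i\in V_j}h(X_i)$, and $h(X_i)\le h(V_j)$ for all $X_i\in V_j$. If a maximization is unbounded its optimal value is $+\infty$. *)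

theory Defs
  imports Complex_Main "HOL-Library.Extended_Real"
begin

section \<open>Conjunctive queries\<close>

text \<open>
  The atoms are \<open>R\<^sub>1, \<dots>, R\<^sub>m\<close> with \<open>m = natoms Q\<close>; only the set of variables of an atom
  matters. Atoms are identified by their index, so two atoms may have the same variable set.
\<close>

record 'x cquery =
  natoms :: nat
  atom_vars :: "nat \<Rightarrow> 'x set"
  out_vars :: "'x set"

definition atoms :: "'x cquery \<Rightarrow> nat set" where
  "atoms Q = {1..natoms Q}"

definition query_vars :: "'x cquery \<Rightarrow> 'x set" where
  "query_vars Q = (\<Union>j\<in>atoms Q. atom_vars Q j)"

definition conj_query :: "'x cquery \<Rightarrow> bool" where
  "conj_query Q \<longleftrightarrow>
     (\<forall>j\<in>atoms Q. finite (atom_vars Q j) \<and> atom_vars Q j \<noteq> {}) \<and>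
     out_vars Q \<subseteq> query_vars Q"

definition full_query :: "'x cquery \<Rightarrow> bool" where
  "full_query Q \<longleftrightarrow> out_vars Q = query_vars Q"

section \<open>Acyclicity\<close>

text \<open>
  Undirected simple graphs are given by a set of edges, each edge being a two-element set of nodes.
  (The notion \<open>tree\<close> of the AFP entry Graph Theory only excludes directed cycles, so it does
  not describe undirected trees.)
\<close>

definition connected_nodes :: "'n set set \<Rightarrow> 'n set \<Rightarrow> bool" where
  "connected_nodes E S \<longleftrightarrow>
     (\<forall>u\<in>S. \<forall>v\<in>S. (u, v) \<in> {(x, y). x \<in> S \<and> y \<in> S \<and> {x, y} \<in> E}\<^sup>*)"

definition graph_cycle :: "'n set set \<Rightarrow> 'n list \<Rightarrow> bool" where
  "graph_cycle E vs \<longleftrightarrow>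
     3 \<le> length vs \<and> distinct vs \<and>
     (\<forall>i<length vs. {vs ! i, vs ! (Suc i mod length vs)} \<in> E)"

definition undirected_tree :: "'n set \<Rightarrow> 'n set set \<Rightarrow> bool" where
  "undirected_tree N E \<longleftrightarrow>
     finite N \<and> N \<noteq> {} \<and>
     E \<subseteq> {{u, v} | u v. u \<in> N \<and> v \<in> N \<and> u \<noteq> v} \<and>
     connected_nodes E N \<and> (\<nexists>vs. graph_cycle E vs)"

text \<open>
  Each tree node carries exactly one atom, so the atom indices themselves serve as the nodes.
\<close>

definition acyclic_query :: "'x cquery \<Rightarrow> bool" where
  "acyclic_query Q \<longleftrightarrow>
     (\<exists>E. undirected_tree (atoms Q) E \<and>
          (\<forall>x\<in>query_vars Q. connected_nodes E {j \<in> atoms Q. x \<in> atom_vars Q j}))"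

definition berge_acyclic :: "'x cquery \<Rightarrow> bool" where
  "berge_acyclic Q \<longleftrightarrow>
     acyclic_query Q \<and>
     (\<forall>i\<in>atoms Q. \<forall>j\<in>atoms Q. i \<noteq> j \<longrightarrow> card (atom_vars Q i \<inter> atom_vars Q j) \<le> 1)"

section \<open>Statistics\<close>

text \<open>
  \<open>(j, U, V, p, b)\<close> stands for the assertion that the \<open>p\<close>-norm of the degree sequence from \<open>U\<close>
  to \<open>V\<close> in \<open>R\<^sub>j\<close> is at most \<open>b\<close>; the value \<open>p = \<infinity>\<close> is allowed.
\<close>

type_synonym 'x statistic = "nat \<times> 'x set \<times> 'x set \<times> ereal \<times> real"

definition is_statistic :: "'x cquery \<Rightarrow> 'x statistic \<Rightarrow> bool" where
  "is_statistic Q = (\<lambda>(j, U, V, p, b).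
     j \<in> atoms Q \<and> U \<subseteq> atom_vars Q j \<and> V \<subseteq> atom_vars Q j \<and> 0 < p \<and> 1 \<le> b)"

definition simple_statistic :: "'x statistic \<Rightarrow> bool" where
  "simple_statistic = (\<lambda>(j, U, V, p, b). finite U \<and> card U \<le> 1)"

definition full_statistic :: "'x cquery \<Rightarrow> 'x statistic \<Rightarrow> bool" where
  "full_statistic Q = (\<lambda>(j, U, V, p, b). U \<union> V = atom_vars Q j)"

section \<open>The linear programs\<close>

definition cond :: "('x set \<Rightarrow> real) \<Rightarrow> 'x set \<Rightarrow> 'x set \<Rightarrow> real" where
  "cond h V U = h (U \<union> V) - h U"

text \<open>In \<^typ>\<open>ereal\<close> we have \<open>1 / \<infinity> = 0\<close>.\<close>

definition stat_constraints :: "'x statistic set \<Rightarrow> ('x set \<Rightarrow> real) \<Rightarrow> bool" where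
  "stat_constraints \<Sigma> h \<longleftrightarrow>
     (\<forall>(j, U, V, p, b)\<in>\<Sigma>. real_of_ereal (1 / p) * h U + cond h V U \<le> log 2 b)"

definition base_feasible :: "'x cquery \<Rightarrow> 'x statistic set \<Rightarrow> ('x set \<Rightarrow> real) \<Rightarrow> bool" where
  "base_feasible Q \<Sigma> h \<longleftrightarrow>
     (\<forall>U\<subseteq>query_vars Q. 0 \<le> h U) \<and>
     stat_constraints \<Sigma> h \<and>
     h {} = 0 \<and>
     (\<forall>U\<subseteq>query_vars Q. \<forall>V\<subseteq>query_vars Q.
        h U \<le> h (U \<union> V) \<and> h (U \<union> V) + h (U \<inter> V) \<le> h U + h V)"

text \<open>
  Optimal values are suprema in the extended reals, so that an unbounded program has value \<open>\<infinity>\<close>.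
\<close>

definition LP_base :: "'x cquery \<Rightarrow> 'x statistic set \<Rightarrow> ereal" where
  "LP_base Q \<Sigma> = (SUP h\<in>{h. base_feasible Q \<Sigma> h}. ereal (h (query_vars Q)))"

text \<open>
  In the Berge program the variables are again indexed by sets, so that \<open>h {x}\<close> and
  \<open>h (atom_vars Q j)\<close> are the same variable if \<open>atom_vars Q j = {x}\<close>. Only the values of \<open>h\<close> at the
  singletons, at the sets \<open>atom_vars Q j\<close> and at \<open>{}\<close> occur; \<open>h {}\<close> is the constant \<open>0\<close>.
\<close>

definition atom_count :: "'x cquery \<Rightarrow> 'x \<Rightarrow> nat" where
  "atom_count Q x = card {j \<in> atoms Q. x \<in> atom_vars Q j}"

definition berge_objective :: "'x cquery \<Rightarrow> ('x set \<Rightarrow> real) \<Rightarrow> real" where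
  "berge_objective Q h =
     (\<Sum>j\<in>atoms Q. h (atom_vars Q j)) -
     (\<Sum>x\<in>query_vars Q. (real (atom_count Q x) - 1) * h {x})"

definition berge_feasible :: "'x cquery \<Rightarrow> 'x statistic set \<Rightarrow> ('x set \<Rightarrow> real) \<Rightarrow> bool" where
  "berge_feasible Q \<Sigma> h \<longleftrightarrow>
     (\<forall>x\<in>query_vars Q. 0 \<le> h {x}) \<and>
     (\<forall>j\<in>atoms Q. 0 \<le> h (atom_vars Q j)) \<and>
     h {} = 0 \<and>
     stat_constraints \<Sigma> h \<and>
     (\<forall>j\<in>atoms Q.
        h (atom_vars Q j) \<le> (\<Sum>x\<in>atom_vars Q j. h {x}) \<and>
        (\<forall>x\<in>atom_vars Q j. h {x} \<le> h (atom_vars Q j)))"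

definition LP_Berge :: "'x cquery \<Rightarrow> 'x statistic set \<Rightarrow> ereal" where
  "LP_Berge Q \<Sigma> = (SUP h\<in>{h. berge_feasible Q \<Sigma> h}. ereal (berge_objective Q h))"

end

theory Submission
  imports Defs
begin

text \<open>
  A join tree can be built up one node at a time so that each new atom meets the union of the earlier
  ones inside a single earlier atom, hence, by Berge-acyclicity, in at most one variable. Adding the
  corresponding submodularity inequalities shows \<open>h(\<^bold>V) \<le> E\<^sub>Q(h)\<close> for every polymatroid \<open>h\<close>.
  Conversely, a feasible point of the Berge program is realised on each single atom by the truncated
  modular function \<open>U \<mapsto> min (h(V\<^sub>j)) (\<Sum>x\<in>U. h(x))\<close>. Two polymatroids \<open>f\<close> on \<open>A\<close> and \<open>k\<close> on \<open>B\<close>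
  with \<open>A \<inter> B = {x}\<close> and \<open>f(x) = k(x) = a\<close> have the common extension
  \<open>U \<mapsto> min (F(U)) (F(U \<union> {x}) - a)\<close>, where \<open>F(U) = f(U \<inter> A) + k(U \<inter> B)\<close>, whose value at \<open>A \<union> B\<close> is
  \<open>f(A) + k(B) - a\<close>. Gluing along the tree yields a polymatroid with value \<open>E\<^sub>Q(h)\<close> at \<open>\<^bold>V\<close>.
\<close>

section \<open>Growing a join tree\<close>

text \<open>The path is built from its end; if the node to be prepended already lies on it, cutting
  back to that occurrence keeps the nodes distinct.\<close>

lemma connected_nodes_simple_path:
  assumes "connected_nodes E S" "u \<in> S" "v \<in> S"
  obtains p where "p \<noteq> []" "hd p = u" "last p = v" "distinct p" "set p \<subseteq> S"
    "successively (\<lambda>x y. {x, y} \<in> E) p"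
proof -
  let ?R = "{(x, y). x \<in> S \<and> y \<in> S \<and> {x, y} \<in> E}"
  have "(u, v) \<in> ?R\<^sup>*"
    using assms by (auto simp: connected_nodes_def)
  then have "\<exists>p. p \<noteq> [] \<and> hd p = u \<and> last p = v \<and> distinct p \<and> set p \<subseteq> S \<and>
      successively (\<lambda>x y. {x, y} \<in> E) p"
  proof (induction rule: converse_rtrancl_induct)
    case base
    show ?case
      using assms(3) by (intro exI[of _ "[v]"]) auto
  next
    case (step y z)
    then obtain p where p: "p \<noteq> []" "hd p = z" "last p = v" "distinct p" "set p \<subseteq> S"
      "successively (\<lambda>x y. {x, y} \<in> E) p"
      by blast
    show ?case
    proof (cases "y \<in> set p")
      case True
      then obtain as bs where "p = as @ y # bs"
        by (meson split_list)
      with p show ?thesis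
        by (intro exI[of _ "y # bs"]) (auto simp: successively_append_iff)
    next
      case False
      with p step.hyps(1) show ?thesis
        by (intro exI[of _ "y # p"]) (auto simp: successively_Cons)
    qed
  qed
  with that show thesis
    by blast
qed

text \<open>If \<open>q\<close> were outside \<open>T\<close>, a path within \<open>T\<close> from
  \<open>l\<close> to \<open>S\<close>, continued within \<open>S\<close> to \<open>q\<close>, would
  close up to a cycle through the edge \<open>{q, l}\<close>. In the join tree, \<open>S\<close>
  holds the nodes added so far and \<open>T\<close> the nodes whose atom contains a given variable
  of atom \<open>l\<close>.\<close>

lemma acyclic_no_detour:
  assumes acyc: "\<nexists>vs. graph_cycle E vs"
    and S: "connected_nodes E S" "q \<in> S" "l \<notin> S" "{q, l} \<in> E"
    and T: "connected_nodes E T" "l \<in> T" "s \<in> T" "s \<in> S"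
  shows "q \<in> T"
proof (rule ccontr)
  assume "q \<notin> T"
  let ?adj = "\<lambda>x y. {x, y} \<in> E"
  obtain p where p: "p \<noteq> []" "hd p = l" "last p = s" "distinct p" "set p \<subseteq> T" "successively ?adj p"
    using connected_nodes_simple_path T(1-3) by metis
  have "\<exists>x\<in>set p. x \<in> S"
    using p(1,3) T(4) last_in_set by blast
  \<comment> \<open>Stopping at the first node \<open>t\<close> in \<open>S\<close> keeps
    \<open>ys\<close> outside \<open>S\<close>, hence disjoint from the path \<open>r\<close> chosen
    inside \<open>S\<close> below.\<close>
  then obtain ys t zs where ys: "p = ys @ t # zs" "t \<in> S" "\<forall>y\<in>set ys. y \<notin> S"
    using split_list_first_prop[of p "\<lambda>x. x \<in> S"] by blast
  have "ys \<noteq> []" and hd_ys: "hd ys = l"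
    using p(2) ys S(3) by (cases ys; auto)+
  obtain r where r: "r \<noteq> []" "hd r = t" "last r = q" "distinct r" "set r \<subseteq> S" "successively ?adj r"
    using connected_nodes_simple_path S(1) ys(2) S(2) by metis
  \<comment> \<open>\<open>t\<close> lies in \<open>T\<close> and \<open>q\<close> does not, so
    \<open>r\<close> has at least two nodes; with \<open>l\<close> in \<open>ys\<close> this makes
    the three that a cycle needs.\<close>
  have "t \<noteq> q"
    using \<open>q \<notin> T\<close> p(5) ys(1) by auto
  then have "2 \<le> length r"
    using r(1-3) by (cases r; cases "tl r") auto
  moreover have "1 \<le> length ys"
    using \<open>ys \<noteq> []\<close> by (cases ys) auto
  ultimately have len: "3 \<le> length (ys @ r)"
    by simp
  let ?c = "ys @ r"
  have dist: "distinct ?c"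
    using p(4) r ys by auto
  have succ: "successively ?adj ?c"
    using p(6) r ys(1) by (auto simp: successively_append_iff)
  have "{?c ! i, ?c ! (Suc i mod length ?c)} \<in> E" if "i < length ?c" for i
  proof (cases "Suc i < length ?c")
    case True
    then show ?thesis
      using succ by (simp add: successively_conv_nth del: length_append)
  next
    case False
    \<comment> \<open>The wrap-around pair consists of \<open>q\<close> and \<open>l\<close>, joined
      by the given edge.\<close>
    with that have i: "Suc i = length ?c"
      by linarith
    have "?c ! i = q"
      using i r(1,3) last_conv_nth[of ?c] by (simp flip: i del: length_append)
    moreover have "?c ! 0 = l"
      using hd_ys \<open>ys \<noteq> []\<close> hd_conv_nth[of ?c] by simp
    ultimately show ?thesis
      using S(4) i by (simp del: length_append)
  qed
  then have "graph_cycle E ?c"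
    using len dist by (auto simp: graph_cycle_def)
  with acyc show False
    by blast
qed

lemma connected_nodes_crossing_edge:
  assumes "connected_nodes E N" "S \<subseteq> N" "S \<noteq> {}" "S \<noteq> N"
  obtains q l where "q \<in> S" "l \<in> N - S" "{q, l} \<in> E"
proof -
  obtain u v where u: "u \<in> S" and v: "v \<in> N - S"
    using assms by blast
  let ?R = "{(x, y). x \<in> N \<and> y \<in> N \<and> {x, y} \<in> E}"
  have "(u, v) \<in> ?R\<^sup>*"
    using assms u v by (auto simp: connected_nodes_def)
  then have "v \<in> S \<or> (\<exists>q\<in>S. \<exists>l\<in>N - S. {q, l} \<in> E)"
    using u by (induction rule: rtrancl_induct) auto
  with v that show thesis
    by blast
qed

lemma connected_nodes_insert:
  assumes "connected_nodes E S" "q \<in> S" "{q, l} \<in> E"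
  shows "connected_nodes E (insert l S)"
proof -
  let ?R = "\<lambda>S. {(x, y). x \<in> S \<and> y \<in> S \<and> {x, y} \<in> E}"
  let ?T = "?R (insert l S)"
  have mono: "(?R S)\<^sup>* \<subseteq> ?T\<^sup>*"
    by (intro rtrancl_mono) auto
  have ql: "(q, l) \<in> ?T" "(l, q) \<in> ?T"
    using assms by (auto simp: insert_commute)
  have "(u, q) \<in> ?T\<^sup>*" "(q, u) \<in> ?T\<^sup>*" if "u \<in> insert l S" for u
    using that assms(1,2) mono ql by (auto simp: connected_nodes_def)
  then show ?thesis
    unfolding connected_nodes_def by (meson rtrancl_trans)
qed

text \<open>\<open>S\<close> grows along tree edges \<open>{q, l}\<close> and stays connected. A
  variable of atom \<open>l\<close> that occurs in an earlier atom has a connected node set meeting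
  \<open>S\<close>, so by \<open>acyclic_no_detour\<close> this set contains \<open>q\<close>: the
  running intersection property.\<close>

lemma join_tree_induct:
  assumes tree: "undirected_tree N E"
    and conn: "\<And>x. x \<in> (\<Union>j\<in>N. V j) \<Longrightarrow> connected_nodes E {j \<in> N. x \<in> V j}"
    and single: "\<And>r. r \<in> N \<Longrightarrow> P {r}"
    and grow: "\<And>S q l. \<lbrakk>S \<subseteq> N; q \<in> S; l \<in> N - S; V l \<inter> (\<Union>j\<in>S. V j) \<subseteq> V q; P S\<rbrakk>
      \<Longrightarrow> P (insert l S)"
  shows "P N"
proof -
  have N: "finite N" "N \<noteq> {}" "connected_nodes E N" "\<nexists>vs. graph_cycle E vs"
    using tree by (auto simp: undirected_tree_def)
  have "P N" if "S \<subseteq> N" "S \<noteq> {}" "connected_nodes E S" "P S" for S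
    using that
  proof (induction "card (N - S)" arbitrary: S rule: less_induct)
    case less
    show ?case
    proof (cases "S = N")
      case True
      with less.prems show ?thesis
        by simp
    next
      case False
      with less.prems N(3) obtain q l where ql: "q \<in> S" "l \<in> N - S" "{q, l} \<in> E"
        using connected_nodes_crossing_edge by metis
      have "V l \<inter> (\<Union>j\<in>S. V j) \<subseteq> V q"
      proof
        fix x assume "x \<in> V l \<inter> (\<Union>j\<in>S. V j)"
        then obtain s where x: "x \<in> V l" "s \<in> S" "x \<in> V s"
          by blast
        have "connected_nodes E {j \<in> N. x \<in> V j}"
          using conn ql x by blast
        then have "q \<in> {j \<in> N. x \<in> V j}"
          using acyclic_no_detour[OF N(4) less.prems(3) ql(1) _ ql(3)] ql x less.prems(1) by blast
        then show "x \<in> V q"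
          by simp
      qed
      then have "P (insert l S)"
        using grow ql less.prems by blast
      moreover have "card (N - insert l S) < card (N - S)"
        using ql N(1) by (intro psubset_card_mono) auto
      moreover have "connected_nodes E (insert l S)"
        using connected_nodes_insert less.prems(3) ql by metis
      ultimately show ?thesis
        using less.hyps less.prems ql by blast
    qed
  qed
  moreover obtain r where "r \<in> N"
    using N(2) by blast
  ultimately show ?thesis
    using single[of r] by (auto simp: connected_nodes_def)
qed

text \<open>The overlap with the earlier atoms lies in \<open>V q \<inter> V l\<close> for a single
  \<open>q\<close>, which has at most one element. Stating this as inclusion in \<open>{x}\<close>
  also covers an empty overlap, and the tree itself drops out of the induction.\<close>

lemma berge_acyclic_induct:
  assumes cq: "conj_query Q" and berge: "berge_acyclic Q"
    and single: "\<And>r. r \<in> atoms Q \<Longrightarrow> P {r}"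
    and grow: "\<And>S l x. \<lbrakk>S \<subseteq> atoms Q; l \<in> atoms Q; l \<notin> S;
        (\<Union>j\<in>S. atom_vars Q j) \<inter> atom_vars Q l \<subseteq> {x}; P S\<rbrakk> \<Longrightarrow> P (insert l S)"
  shows "P (atoms Q)"
proof -
  obtain E where "undirected_tree (atoms Q) E"
    "\<And>x. x \<in> (\<Union>j\<in>atoms Q. atom_vars Q j) \<Longrightarrow> connected_nodes E {j \<in> atoms Q. x \<in> atom_vars Q j}"
    using berge unfolding berge_acyclic_def acyclic_query_def query_vars_def by blast
  then show ?thesis
  proof (rule join_tree_induct)
    fix S q l
    assume S: "S \<subseteq> atoms Q" "q \<in> S" "l \<in> atoms Q - S" "P S"
      and sub: "atom_vars Q l \<inter> (\<Union>j\<in>S. atom_vars Q j) \<subseteq> atom_vars Q q"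
    have "card (atom_vars Q q \<inter> atom_vars Q l) \<le> 1"
      using berge S by (auto simp: berge_acyclic_def)
    moreover have "finite (atom_vars Q q \<inter> atom_vars Q l)"
      using cq S by (auto simp: conj_query_def)
    ultimately obtain x where "atom_vars Q q \<inter> atom_vars Q l \<subseteq> {x}"
      by (metis card_le_Suc0_iff_eq One_nat_def empty_subsetI ex_in_conv singletonI subsetI singleton_iff)
    then show "P (insert l S)"
      using grow[of S l x] S sub by blast
  qed (use single in auto)
qed

section \<open>The objective of the Berge program\<close>

text \<open>\<open>E_Q\<close> for the subquery with atoms \<open>S\<close>, regrouped so that no
  occurrence counts appear: each variable is subtracted once per atom containing it and added back
  once.\<close>

definition partial_objective ::
    "'x cquery \<Rightarrow> ('x set \<Rightarrow> real) \<Rightarrow> nat set \<Rightarrow> real" where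
  "partial_objective Q h S =
     (\<Sum>j\<in>S. h (atom_vars Q j) - (\<Sum>x\<in>atom_vars Q j. h {x})) +
     (\<Sum>x\<in>(\<Union>j\<in>S. atom_vars Q j). h {x})"

lemma berge_objective_eq_partial:
  assumes "conj_query Q"
  shows "berge_objective Q h = partial_objective Q h (atoms Q)"
proof -
  have fin: "finite (atoms Q)" "finite (query_vars Q)"
    and fa: "\<And>j. j \<in> atoms Q \<Longrightarrow> finite (atom_vars Q j)"
    using assms by (auto simp: conj_query_def query_vars_def atoms_def)
  have "(\<Sum>j\<in>atoms Q. \<Sum>x\<in>atom_vars Q j. h {x}) =
      (\<Sum>j\<in>atoms Q. \<Sum>x | x \<in> query_vars Q \<and> x \<in> atom_vars Q j. h {x})"
    by (intro sum.cong refl) (auto simp: query_vars_def)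
  \<comment> \<open>Double counting of the incidences between atoms and variables.\<close>
  also have "\<dots> = (\<Sum>x\<in>query_vars Q. \<Sum>j | j \<in> atoms Q \<and> x \<in> atom_vars Q j. h {x})"
    using fin by (rule sum.swap_restrict)
  also have "\<dots> = (\<Sum>x\<in>query_vars Q. real (atom_count Q x) * h {x})"
    by (simp add: atom_count_def)
  finally show ?thesis
    unfolding berge_objective_def partial_objective_def query_vars_def[symmetric]
    by (simp add: sum_subtractf algebra_simps)
qed

lemma partial_objective_singleton [simp]:
  "partial_objective Q h {r} = h (atom_vars Q r)"
  by (simp add: partial_objective_def)

text \<open>Inclusion-exclusion for the sum over variables. The overlap has at most one element, so
  its sum of singleton values is \<open>h\<close> of the overlap itself; \<open>h {} = 0\<close>
  settles the empty case.\<close>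

lemma partial_objective_insert:
  assumes "conj_query Q" "S \<subseteq> atoms Q" "l \<in> atoms Q" "l \<notin> S"
    and "(\<Union>j\<in>S. atom_vars Q j) \<inter> atom_vars Q l \<subseteq> {x}" and "h {} = 0"
  shows "partial_objective Q h (insert l S) = partial_objective Q h S + h (atom_vars Q l)
    - h ((\<Union>j\<in>S. atom_vars Q j) \<inter> atom_vars Q l)"
proof -
  let ?A = "\<Union>j\<in>S. atom_vars Q j" and ?B = "atom_vars Q l"
  have "finite S"
    using assms(2) finite_subset by (auto simp: atoms_def)
  moreover have "finite ?A" "finite ?B"
    using assms(1-3) \<open>finite S\<close> by (auto simp: conj_query_def)
  moreover have "(\<Sum>x\<in>?A \<inter> ?B. h {x}) = h (?A \<inter> ?B)"
    using assms(5,6) by (auto simp: subset_singleton_iff)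
  ultimately show ?thesis
    using assms(4) sum_Un[of ?A ?B "\<lambda>x. h {x}"]
    by (simp add: partial_objective_def Un_commute)
qed

section \<open>From the basic program to the Berge program\<close>

lemma base_feasible_le_berge_objective:
  assumes cq: "conj_query Q" and "berge_acyclic Q" and h: "base_feasible Q \<Sigma> h"
  shows "h (query_vars Q) \<le> berge_objective Q h"
proof -
  have "h (\<Union>j\<in>atoms Q. atom_vars Q j) \<le> partial_objective Q h (atoms Q)"
    using cq assms(2)
  proof (rule berge_acyclic_induct[where P = "\<lambda>S. h (\<Union>j\<in>S. atom_vars Q j) \<le> partial_objective Q h S"])
    fix S l x
    assume S: "S \<subseteq> atoms Q" "l \<in> atoms Q" "l \<notin> S"
        "(\<Union>j\<in>S. atom_vars Q j) \<inter> atom_vars Q l \<subseteq> {x}"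
      and IH: "h (\<Union>j\<in>S. atom_vars Q j) \<le> partial_objective Q h S"
    have "(\<Union>j\<in>S. atom_vars Q j) \<subseteq> query_vars Q" "atom_vars Q l \<subseteq> query_vars Q"
      using S by (auto simp: query_vars_def)
    \<comment> \<open>The overlap term of submodularity is the one subtracted in
      \<open>partial_objective_insert\<close>.\<close>
    then have "h ((\<Union>j\<in>S. atom_vars Q j) \<union> atom_vars Q l) + h ((\<Union>j\<in>S. atom_vars Q j) \<inter> atom_vars Q l)
        \<le> h (\<Union>j\<in>S. atom_vars Q j) + h (atom_vars Q l)"
      using h by (auto simp: base_feasible_def)
    then show "h (\<Union>j\<in>insert l S. atom_vars Q j) \<le> partial_objective Q h (insert l S)"
      using IH partial_objective_insert[OF cq S, of h] h
      by (simp add: base_feasible_def Un_commute)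
  qed simp
  then show ?thesis
    using cq by (simp add: berge_objective_eq_partial query_vars_def)
qed

text \<open>The statistics constraints are shared; the additivity constraints are subadditivity over
  singletons and monotonicity.\<close>

lemma base_feasible_imp_berge_feasible:
  assumes cq: "conj_query Q" and h: "base_feasible Q \<Sigma> h"
  shows "berge_feasible Q \<Sigma> h"
proof -
  have subadd: "h U \<le> (\<Sum>x\<in>U. h {x})" if "finite U" "U \<subseteq> query_vars Q" for U
    using that
  proof (induction rule: finite_induct)
    case empty
    then show ?case
      using h by (simp add: base_feasible_def)
  next
    case (insert x U)
    then have sub: "{x} \<subseteq> query_vars Q" "U \<subseteq> query_vars Q"
      by auto
    then have "h ({x} \<union> U) + h ({x} \<inter> U) \<le> h {x} + h U"
      using h unfolding base_feasible_def by blast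
    with insert sub h show ?case
      by (simp add: base_feasible_def)
  qed
  have mono: "h {x} \<le> h U" if "x \<in> U" "U \<subseteq> query_vars Q" for x U
  proof -
    have "{x} \<subseteq> query_vars Q"
      using that by auto
    then have "h {x} \<le> h ({x} \<union> U)"
      using that(2) h by (simp add: base_feasible_def del: Un_insert_left)
    with that show ?thesis
      by (simp add: insert_absorb)
  qed
  have "finite (atom_vars Q j)" "atom_vars Q j \<subseteq> query_vars Q" if "j \<in> atoms Q" for j
    using cq that by (auto simp: conj_query_def query_vars_def)
  with h subadd mono show ?thesis
    by (auto simp: berge_feasible_def base_feasible_def)
qed

section \<open>Gluing polymatroids\<close>

text \<open>The inequalities are required on all sets of the type, so restricting and gluing need no
  side conditions on ground sets.\<close>

definition polymatroid :: "('x set \<Rightarrow> real) \<Rightarrow> bool" where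
  "polymatroid f \<longleftrightarrow> f {} = 0 \<and> (\<forall>U W. U \<subseteq> W \<longrightarrow> f U \<le> f W) \<and>
     (\<forall>U W. f (U \<union> W) + f (U \<inter> W) \<le> f U + f W)"

lemma polymatroidI:
  assumes "f {} = 0" "\<And>U W. U \<subseteq> W \<Longrightarrow> f U \<le> f W"
    "\<And>U W. f (U \<union> W) + f (U \<inter> W) \<le> f U + f W"
  shows "polymatroid f"
  using assms by (simp add: polymatroid_def)

lemma
  assumes "polymatroid f"
  shows polymatroid_empty: "f {} = 0"
    and polymatroid_mono: "U \<subseteq> W \<Longrightarrow> f U \<le> f W"
    and polymatroid_submodular: "f (U \<union> W) + f (U \<inter> W) \<le> f U + f W"
    and polymatroid_nonneg: "0 \<le> f U"
  using assms empty_subsetI[of U] unfolding polymatroid_def by metis+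

lemma polymatroid_restrict:
  assumes "polymatroid f"
  shows "polymatroid (\<lambda>U. f (U \<inter> A))"
proof (rule polymatroidI)
  fix U W
  show "f ((U \<union> W) \<inter> A) + f (U \<inter> W \<inter> A) \<le> f (U \<inter> A) + f (W \<inter> A)"
    using polymatroid_submodular[OF assms, of "U \<inter> A" "W \<inter> A"]
    by (simp add: Int_Un_distrib Int_Un_distrib2 Int_ac)
qed (auto simp: polymatroid_empty[OF assms] intro: polymatroid_mono[OF assms])

lemma polymatroid_add:
  assumes "polymatroid f" "polymatroid k"
  shows "polymatroid (\<lambda>U. f U + k U)"
proof (rule polymatroidI)
  fix U W
  show "f (U \<union> W) + k (U \<union> W) + (f (U \<inter> W) + k (U \<inter> W)) \<le> f U + k U + (f W + k W)"
    using assms[THEN polymatroid_submodular, of U W] by simp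
qed (auto simp: assms[THEN polymatroid_empty] intro!: add_mono assms[THEN polymatroid_mono])

lemma polymatroid_truncate:
  assumes f: "polymatroid f" and c: "0 \<le> c"
  shows "polymatroid (\<lambda>U. min c (f U))"
proof (rule polymatroidI)
  fix U W
  \<comment> \<open>\<open>f U\<close> and \<open>f W\<close> lie between the values at the
    intersection and the union, which lets submodularity survive the cut at
    \<open>c\<close>.\<close>
  have "f (U \<union> W) + f (U \<inter> W) \<le> f U + f W" "f (U \<inter> W) \<le> f U" "f (U \<inter> W) \<le> f W"
      "f U \<le> f (U \<union> W)" "f W \<le> f (U \<union> W)"
    using polymatroid_submodular[OF f] by (auto intro: polymatroid_mono[OF f])
  then show "min c (f (U \<union> W)) + min c (f (U \<inter> W)) \<le> min c (f U) + min c (f W)"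
    by linarith
next
  fix U W :: "'a set" assume "U \<subseteq> W"
  then show "min c (f U) \<le> min c (f W)"
    using polymatroid_mono[OF f] by (meson min.mono order_refl)
qed (simp add: polymatroid_empty[OF f] c)

lemma polymatroid_modular:
  assumes "finite B" "\<And>x. x \<in> B \<Longrightarrow> 0 \<le> a x"
  shows "polymatroid (\<lambda>U. \<Sum>x\<in>U \<inter> B. a x :: real)"
proof (rule polymatroidI)
  fix U W
  show "(\<Sum>x\<in>(U \<union> W) \<inter> B. a x) + (\<Sum>x\<in>U \<inter> W \<inter> B. a x) \<le> (\<Sum>x\<in>U \<inter> B. a x) + (\<Sum>x\<in>W \<inter> B. a x)"
    using assms sum.union_inter[of "U \<inter> B" "W \<inter> B" a]
    by (simp add: Int_Un_distrib Int_Un_distrib2 Int_ac)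
qed (use assms in \<open>auto intro!: sum_mono2\<close>)

text \<open>
  If \<open>F {x} = 2 * a\<close> comes from two independent copies of \<open>x\<close>, this makes the copies parallel,
  as in a parallel connection of matroids.
\<close>

lemma polymatroid_merge:
  assumes F: "polymatroid F" and a: "0 \<le> a" "a \<le> F {x}"
  shows "polymatroid (\<lambda>U. min (F U) (F (insert x U) - a))"
proof (rule polymatroidI)
  fix U W
  let ?g = "\<lambda>U. min (F U) (F (insert x U) - a)"
  \<comment> \<open>One inequality for each choice of terms attaining the minima at \<open>U\<close>
    and \<open>W\<close>: both plain (1), both shifted (2), mixed (3, 4). If \<open>x\<close> is
    already in the set, the shifted term is the minimum because \<open>a\<close> is
    non-negative.\<close>
  have 1: "F (U \<union> W) + F (U \<inter> W) \<le> F U + F W"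
    by (rule polymatroid_submodular[OF F])
  have 2: "F (insert x (U \<union> W)) + F (insert x (U \<inter> W)) \<le> F (insert x U) + F (insert x W)"
    using polymatroid_submodular[OF F, of "insert x U" "insert x W"] by simp
  have 3: "F (insert x (U \<union> W)) + F (U \<inter> W) \<le> F U + F (insert x W)" if "x \<notin> U"
    using polymatroid_submodular[OF F, of U "insert x W"] that by simp
  have 4: "F (insert x (U \<union> W)) + F (U \<inter> W) \<le> F (insert x U) + F W" if "x \<notin> W"
    using polymatroid_submodular[OF F, of "insert x U" W] that by simp
  have 5: "insert x U = U" if "x \<in> U"
    using that by blast
  have 6: "insert x W = W" if "x \<in> W"
    using that by blast
  show "?g (U \<union> W) + ?g (U \<inter> W) \<le> ?g U + ?g W"
    using 1 2 3 4 5 6 a(1) by (cases "x \<in> U"; cases "x \<in> W") (auto simp: min_def)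
next
  fix U W :: "'a set" assume "U \<subseteq> W"
  then have "F U \<le> F W" "F (insert x U) \<le> F (insert x W)"
    by (auto intro!: polymatroid_mono[OF F])
  then show "min (F U) (F (insert x U) - a) \<le> min (F W) (F (insert x W) - a)"
    by linarith
\<comment> \<open>At \<open>{}\<close> the minimum is 0 because
  \<open>a \<le> F {x}\<close>.\<close>
qed (use a polymatroid_empty[OF F] in simp)

lemma polymatroid_glue:
  assumes f: "polymatroid f" and k: "polymatroid k"
    and AB: "A \<inter> B \<subseteq> {x}" and eq: "f (A \<inter> B) = k (A \<inter> B)"
  obtains g where "polymatroid g" "\<And>U. U \<subseteq> A \<Longrightarrow> g U = f U" "\<And>U. U \<subseteq> B \<Longrightarrow> g U = k U"
    "g (A \<union> B) = f A + k B - f (A \<inter> B)"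
proof -
  define F where "F U = f (U \<inter> A) + k (U \<inter> B)" for U
  have F: "polymatroid F"
    unfolding F_def by (intro polymatroid_add polymatroid_restrict f k)
  note empty = polymatroid_empty[OF f] polymatroid_empty[OF k]
  consider "A \<inter> B = {}" | "A \<inter> B = {x}"
    using AB by blast
  then show thesis
  proof cases
    case 1
    \<comment> \<open>With disjoint ground sets the direct sum \<open>F\<close> is already the
      common extension.\<close>
    have "F U = f U" if "U \<subseteq> A" for U
    proof -
      have "U \<inter> A = U" "U \<inter> B = {}"
        using that 1 by auto
      then show ?thesis
        by (simp add: F_def empty)
    qed
    moreover have "F U = k U" if "U \<subseteq> B" for U
    proof -
      have "U \<inter> B = U" "U \<inter> A = {}"
        using that 1 by auto
      then show ?thesis
        by (simp add: F_def empty)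
    qed
    moreover have "F (A \<union> B) = f A + k B - f (A \<inter> B)"
      by (simp add: F_def 1 empty Int_absorb1)
    ultimately show thesis
      using F that by blast
  next
    case 2
    define a where "a = f {x}"
    have a: "f {x} = a" "k {x} = a" "0 \<le> a"
      using eq polymatroid_nonneg[OF f, of "{x}"] by (simp_all add: 2 a_def)
    have x: "x \<in> A" "x \<in> B"
      using 2 by auto
    define g where "g U = min (F U) (F (insert x U) - a)" for U
    have "a \<le> F {x}"
      using a x by (simp add: F_def)
    then have "polymatroid g"
      unfolding g_def using F a(3) by (intro polymatroid_merge)
    moreover have "g U = f U" if U: "U \<subseteq> A" for U
    proof -
      \<comment> \<open>If \<open>x\<close> is not in \<open>U\<close>, the two terms are
        \<open>f U\<close> and \<open>f (insert x U)\<close>; if it is, they are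
        \<open>f U + a\<close> and \<open>f U\<close>.\<close>
      have *: "U \<inter> A = U" "insert x U \<inter> A = insert x U" "insert x U \<inter> B = {x}"
        "U \<inter> B = (if x \<in> U then {x} else {})"
        using U 2 x by auto
      have "f U \<le> f (insert x U)"
        by (auto intro: polymatroid_mono[OF f])
      then show ?thesis
        using a by (auto simp: g_def F_def * empty insert_absorb)
    qed
    moreover have "g U = k U" if U: "U \<subseteq> B" for U
    proof -
      have *: "U \<inter> B = U" "insert x U \<inter> B = insert x U" "insert x U \<inter> A = {x}"
        "U \<inter> A = (if x \<in> U then {x} else {})"
        using U 2 x by auto
      have "k U \<le> k (insert x U)"
        by (auto intro: polymatroid_mono[OF k])
      then show ?thesis
        using a by (auto simp: g_def F_def * empty insert_absorb)
    qed
    moreover have "g (A \<union> B) = f A + k B - f (A \<inter> B)"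
    proof -
      \<comment> \<open>\<open>x\<close> lies in the union, so the shifted term is the minimum and
        the doubly counted \<open>a\<close> is removed once.\<close>
      have "insert x (A \<union> B) = A \<union> B" "(A \<union> B) \<inter> A = A" "(A \<union> B) \<inter> B = B"
        using x by auto
      then show ?thesis
        using a by (simp add: g_def F_def 2)
    qed
    ultimately show thesis
      using that by blast
  qed
qed

text \<open>Truncating the modular function at \<open>c\<close> works: \<open>c\<close> is at most
  the full sum, so the value at \<open>B\<close> is \<open>c\<close>, and \<open>a x \<le> c\<close>
  leaves the singletons untouched. These are exactly the additivity constraints of one atom.\<close>

lemma polymatroid_prescribed:
  assumes "finite B" and "\<And>x. x \<in> B \<Longrightarrow> 0 \<le> a x" and "0 \<le> c"
    and "c \<le> (\<Sum>x\<in>B. a x)" and "\<And>x. x \<in> B \<Longrightarrow> a x \<le> c"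
  obtains k where "polymatroid k" "k B = c" "\<And>x. x \<in> B \<Longrightarrow> k {x} = a x"
proof
  let ?k = "\<lambda>U. min c (\<Sum>x\<in>U \<inter> B. a x)"
  show "polymatroid ?k"
    using assms by (intro polymatroid_truncate polymatroid_modular) auto
qed (use assms in auto)

section \<open>From the Berge program to the basic program\<close>

text \<open>Gluing along the join tree. Agreement with \<open>h\<close> on singletons is carried
  through the induction because it supplies the compatibility needed at the next overlap.\<close>

lemma berge_feasible_extend:
  assumes cq: "conj_query Q" and berge: "berge_acyclic Q" and h: "berge_feasible Q \<Sigma> h"
  obtains f where "polymatroid f" "\<And>j. j \<in> atoms Q \<Longrightarrow> f (atom_vars Q j) = h (atom_vars Q j)"
    "\<And>x. x \<in> query_vars Q \<Longrightarrow> f {x} = h {x}" "f (query_vars Q) = berge_objective Q h"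
proof -
  have local: "\<exists>k. polymatroid k \<and> k (atom_vars Q j) = h (atom_vars Q j) \<and>
      (\<forall>x\<in>atom_vars Q j. k {x} = h {x})" if "j \<in> atoms Q" for j
  proof -
    have "finite (atom_vars Q j)" "\<And>x. x \<in> atom_vars Q j \<Longrightarrow> 0 \<le> h {x}" "0 \<le> h (atom_vars Q j)"
      "h (atom_vars Q j) \<le> (\<Sum>x\<in>atom_vars Q j. h {x})"
      "\<And>x. x \<in> atom_vars Q j \<Longrightarrow> h {x} \<le> h (atom_vars Q j)"
      using cq h that by (auto simp: conj_query_def berge_feasible_def query_vars_def)
    then show ?thesis
      by (rule polymatroid_prescribed[of "atom_vars Q j" "\<lambda>x. h {x}" "h (atom_vars Q j)"]) auto
  qed
  have h0: "h {} = 0"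
    using h by (simp add: berge_feasible_def)
  define V where "V S = (\<Union>j\<in>S. atom_vars Q j)" for S
  have "\<exists>f. polymatroid f \<and> (\<forall>j\<in>atoms Q. f (atom_vars Q j) = h (atom_vars Q j)) \<and>
      (\<forall>x\<in>V (atoms Q). f {x} = h {x}) \<and> f (V (atoms Q)) = partial_objective Q h (atoms Q)"
    using cq berge
  proof (rule berge_acyclic_induct[where P = "\<lambda>S. \<exists>f. polymatroid f \<and>
      (\<forall>j\<in>S. f (atom_vars Q j) = h (atom_vars Q j)) \<and> (\<forall>x\<in>V S. f {x} = h {x}) \<and>
      f (V S) = partial_objective Q h S"])
    fix r assume "r \<in> atoms Q"
    then show "\<exists>f. polymatroid f \<and> (\<forall>j\<in>{r}. f (atom_vars Q j) = h (atom_vars Q j)) \<and>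
      (\<forall>x\<in>V {r}. f {x} = h {x}) \<and> f (V {r}) = partial_objective Q h {r}"
      using local[of r] by (auto simp: V_def)
  next
    fix S l x
    assume S: "S \<subseteq> atoms Q" "l \<in> atoms Q" "l \<notin> S"
        "(\<Union>j\<in>S. atom_vars Q j) \<inter> atom_vars Q l \<subseteq> {x}"
      and IH: "\<exists>f. polymatroid f \<and> (\<forall>j\<in>S. f (atom_vars Q j) = h (atom_vars Q j)) \<and>
        (\<forall>x\<in>V S. f {x} = h {x}) \<and> f (V S) = partial_objective Q h S"
    from IH obtain f where f: "polymatroid f" "\<forall>j\<in>S. f (atom_vars Q j) = h (atom_vars Q j)"
      "\<forall>x\<in>V S. f {x} = h {x}" "f (V S) = partial_objective Q h S"
      by blast
    obtain k where k: "polymatroid k" "k (atom_vars Q l) = h (atom_vars Q l)"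
      "\<forall>x\<in>atom_vars Q l. k {x} = h {x}"
      using local S(2) by blast
    have int: "V S \<inter> atom_vars Q l \<subseteq> {x}"
      using S(4) by (simp add: V_def)
    then consider "V S \<inter> atom_vars Q l = {}" | "V S \<inter> atom_vars Q l = {x}"
      by blast
    \<comment> \<open>Both functions equal \<open>h\<close> on the overlap, hence each other, as
      gluing demands.\<close>
    then have fh: "f (V S \<inter> atom_vars Q l) = h (V S \<inter> atom_vars Q l)"
      and kh: "k (V S \<inter> atom_vars Q l) = h (V S \<inter> atom_vars Q l)"
      using f(3) k(3) h0 polymatroid_empty[OF f(1)] polymatroid_empty[OF k(1)]
      by (cases; force)+
    obtain g where g: "polymatroid g" "\<And>U. U \<subseteq> V S \<Longrightarrow> g U = f U"
        "\<And>U. U \<subseteq> atom_vars Q l \<Longrightarrow> g U = k U"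
        "g (V S \<union> atom_vars Q l) = f (V S) + k (atom_vars Q l) - f (V S \<inter> atom_vars Q l)"
      using polymatroid_glue[OF f(1) k(1) int] fh kh by metis
    have V: "V (insert l S) = V S \<union> atom_vars Q l"
      by (auto simp: V_def)
    have "\<forall>j\<in>insert l S. g (atom_vars Q j) = h (atom_vars Q j)"
    proof
      fix j assume "j \<in> insert l S"
      then show "g (atom_vars Q j) = h (atom_vars Q j)"
      proof
        assume "j \<in> S"
        then have "atom_vars Q j \<subseteq> V S"
          by (auto simp: V_def)
        with \<open>j \<in> S\<close> show ?thesis
          using g(2) f(2) by simp
      qed (use g(3) k(2) in simp)
    qed
    moreover have "\<forall>x\<in>V (insert l S). g {x} = h {x}"
      unfolding V using g(2,3) f(3) k(3) by auto
    moreover have "g (V (insert l S)) = partial_objective Q h (insert l S)"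
      using partial_objective_insert[OF cq S, of h] h0 g(4) f(4) k(2) fh
      unfolding V by (simp add: V_def)
    ultimately show "\<exists>g. polymatroid g \<and> (\<forall>j\<in>insert l S. g (atom_vars Q j) = h (atom_vars Q j)) \<and>
      (\<forall>x\<in>V (insert l S). g {x} = h {x}) \<and> g (V (insert l S)) = partial_objective Q h (insert l S)"
      using g(1) by blast
  qed
  with that show thesis
    using cq by (auto simp: V_def query_vars_def berge_objective_eq_partial)
qed

text \<open>Simplicity and fullness ensure that a statistics constraint evaluates its function only
  at \<open>{}\<close>, at singletons and at whole atoms, where \<open>f\<close> and
  \<open>h\<close> agree.\<close>

lemma stat_constraints_cong:
  assumes "\<forall>s\<in>\<Sigma>. is_statistic Q s" "\<forall>s\<in>\<Sigma>. simple_statistic s" "\<forall>s\<in>\<Sigma>. full_statistic Q s"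
    and atom: "\<And>j. j \<in> atoms Q \<Longrightarrow> f (atom_vars Q j) = h (atom_vars Q j)"
    and var: "\<And>x. x \<in> query_vars Q \<Longrightarrow> f {x} = h {x}"
    and empty: "f {} = h {}"
    and h: "stat_constraints \<Sigma> h"
  shows "stat_constraints \<Sigma> f"
  unfolding stat_constraints_def
proof (safe)
  fix j U V p b
  assume s: "(j, U, V, p, b) \<in> \<Sigma>"
  have j: "j \<in> atoms Q" "U \<subseteq> atom_vars Q j" "finite U" "card U \<le> 1" "U \<union> V = atom_vars Q j"
    using assms(1-3) s
    by (auto simp: is_statistic_def simple_statistic_def full_statistic_def)
  have "U = {} \<or> (\<exists>x. U = {x})"
    using j(3,4) by (metis card_0_eq card_1_singletonE le_Suc_eq le_zero_eq One_nat_def)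
  then have "f U = h U"
    using empty var j(1,2) by (auto simp: query_vars_def)
  moreover have "f (U \<union> V) = h (U \<union> V)"
    using atom j by simp
  ultimately show "real_of_ereal (1 / p) * f U + cond f V U \<le> log 2 b"
    using h s by (auto simp: stat_constraints_def cond_def)
qed

theorem theorem4p1:
  fixes Q :: "'x cquery" and \<Sigma> :: "'x statistic set"
  assumes "conj_query Q" and "full_query Q" and "berge_acyclic Q"
    and "finite \<Sigma>" and "\<forall>s\<in>\<Sigma>. is_statistic Q s"
    and "\<forall>s\<in>\<Sigma>. simple_statistic s" and "\<forall>s\<in>\<Sigma>. full_statistic Q s"
  shows "LP_base Q \<Sigma> = LP_Berge Q \<Sigma>"
proof (rule antisym)
  show "LP_base Q \<Sigma> \<le> LP_Berge Q \<Sigma>"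
    unfolding LP_base_def LP_Berge_def
  proof (rule SUP_mono)
    fix h assume "h \<in> {h. base_feasible Q \<Sigma> h}"
    then show "\<exists>g\<in>{h. berge_feasible Q \<Sigma> h}. ereal (h (query_vars Q)) \<le> ereal (berge_objective Q g)"
      \<comment> \<open>The same \<open>h\<close> is the witness; its Berge objective can only be
        larger.\<close>
      using assms base_feasible_imp_berge_feasible base_feasible_le_berge_objective
      by (intro bexI[of _ h]) auto
  qed
  show "LP_Berge Q \<Sigma> \<le> LP_base Q \<Sigma>"
    unfolding LP_base_def LP_Berge_def
  proof (rule SUP_mono)
    fix h assume "h \<in> {h. berge_feasible Q \<Sigma> h}"
    then have h: "berge_feasible Q \<Sigma> h"
      by simp
    \<comment> \<open>The values of \<open>h\<close> outside atoms, singletons and \<open>{}\<close>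
      are unconstrained, so \<open>h\<close> is replaced by a polymatroid with the same objective
      value.\<close>
    obtain f where f: "polymatroid f"
      "\<And>j. j \<in> atoms Q \<Longrightarrow> f (atom_vars Q j) = h (atom_vars Q j)"
      "\<And>x. x \<in> query_vars Q \<Longrightarrow> f {x} = h {x}" "f (query_vars Q) = berge_objective Q h"
      using berge_feasible_extend[OF assms(1,3) h] by metis
    have "f {} = h {}" "stat_constraints \<Sigma> h"
      using h polymatroid_empty[OF f(1)] by (simp_all add: berge_feasible_def)
    then have "stat_constraints \<Sigma> f"
      using stat_constraints_cong[OF assms(5-7), of f h] f(2,3) by blast
    then have "base_feasible Q \<Sigma> f"
      using polymatroid_empty[OF f(1)] polymatroid_mono[OF f(1)] polymatroid_submodular[OF f(1)]
        polymatroid_nonneg[OF f(1)]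
      by (simp add: base_feasible_def)
    with f(4) show "\<exists>g\<in>{h. base_feasible Q \<Sigma> h}. ereal (berge_objective Q h) \<le> ereal (g (query_vars Q))"
      by (intro bexI[of _ f]) auto
  qed
qed

end
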